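(* Let $\lambda$ be a fixed nonzero real number, and let $S^{(r)}_{f,\lambda}(n+r,k+r,H)$ be the degenerate generalized $r$-Stirling operators of the first kind associated with the generalized Heisenberg algebra $\mathrm{GHA}_f$, i.e. the coefficients in $(a^{\dagger}a)_{n}=\sum_{k=0}^{n}S_{f,\lambda}^{(r)}(n+r,k+r,H)\big(a^{\dagger}a+[r]_{f}(H)\big)_{k,\lambda}$. For all integers $n,r\ge 0$, $$(a^{\dagger})^{r}(a^{\dagger}a)_{n}=\sum_{k=0}^{n}S_{f,\lambda}^{(r)}\big(n+r,k+r,f^{-r}(H)\big)\,(a^{\dagger}a)_{k,\lambda}\,(a^{\dagger})^{r}.$$
   Context: The generalized Heisenberg algebra $\mathrm{GHA}_f$ is the algebra generated by $\{a,a^{\dagger},H\}$ (together with functions of $H$) subject to the relations $$aH=f(H)a,\qquad Ha^{\dagger}=a^{\dagger}f(H),\qquad [a,a^{\dagger}]=aa^{\dagger}-a^{\dagger}a=f(H)-H,$$ where $H$ is the self-conjugate Hamiltonian and $f(H)$ is an analytic function of $H$; $f$ is assumed to have a compositional inverse $f^{-1}$. Functions of $H$ commute with each other, and the first two relations extend to functions $g$ of $H$: $a\,g(H)=g(f(H))\,a$ and $g(H)\,a^{\dagger}=a^{\dagger}g(f(H))$. For a positive integer $k$, $f^{k}$ is the $k$-fold composition of $f$, $f^{-k}$ is the $k$-fold composition of $f^{-1}$, and $f^{0}$ is the identity. For $k\in\mathbb{Z}$, $[k]_f(H)=f^{k}(H)-H$. Falling factorials: $(x)_0=1$, $(x)_n=x(x-1)\cdots(x-n+1)$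 for $n\ge 1$. Degenerate falling factorials: $(x)_{0,\lambda}=1$, $(x)_{n,\lambda}=x(x-\lambda)(x-2\lambda)\cdots(x-(n-1)\lambda)$ for $n\ge 1$. For an integer $r\ge 0$, the degenerate generalized $r$-Stirling operators of the first kind $S^{(r)}_{f,\lambda}(n+r,k+r,H)$ are the functions of $H$ defined by $$(a^{\dagger}a)_{n}=\sum_{k=0}^{n}S_{f,\lambda}^{(r)}(n+r,k+r,H)\,\big(a^{\dagger}a+[r]_{f}(H)\big)_{k,\lambda}\qquad(n\ge 0),$$ the coefficients (written on the left) being understood as uniquely determined. $S^{(r)}_{f,\lambda}(n+r,k+r,f^{-r}(H))$ denotes the same function with $H$ replaced by $f^{-r}(H)$. *)

theory Defs
  imports "HOL-Analysis.Analysis" "HOL-Library.Poly_Mapping"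
begin

text \<open>
  Functions of the self-conjugate operator \<open>H\<close> are modelled as complex-valued functions on a set
  \<open>D\<close> of real numbers (the values of \<open>H\<close>); \<open>f\<close> is a bijection of \<open>D\<close> onto itself.  They are
  represented by HOL functions \<open>complex \<Rightarrow> complex\<close>, of which only the restriction to \<open>D\<close> matters.
\<close>

definition fpow :: "complex set \<Rightarrow> (complex \<Rightarrow> complex) \<Rightarrow> int \<Rightarrow> complex \<Rightarrow> complex" where
  "fpow D f k = (if 0 \<le> k then f ^^ nat k else inv_into D f ^^ nat (- k))"

definition fbracket :: "complex set \<Rightarrow> (complex \<Rightarrow> complex) \<Rightarrow> int \<Rightarrow> complex \<Rightarrow> complex" where
  "fbracket D f k = (\<lambda>x. fpow D f k x - x)"

text \<open>Products are taken from left to right; the factors commute with each other as soon as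
  \<open>l\<close> commutes with \<open>x\<close>.\<close>

definition ffact :: "'a::ring_1 \<Rightarrow> nat \<Rightarrow> 'a" where
  "ffact x n = prod_list (map (\<lambda>i. x - of_nat i) [0..<n])"

definition dffact :: "'a::ring_1 \<Rightarrow> 'a \<Rightarrow> nat \<Rightarrow> 'a" where
  "dffact l x n = prod_list (map (\<lambda>i. x - of_nat i * l) [0..<n])"

datatype gen = Ann | Cre | Fun "complex \<Rightarrow> complex"

datatype mword = MWord (letters: "gen list")

instantiation mword :: monoid_add
begin
definition "0 = MWord []"
definition "v + w = MWord (letters v @ letters w)"
instance by standard (auto simp: zero_mword_def plus_mword_def)
end

text \<open>The free unital associative complex algebra on the generators: the monoid algebra of the
  free monoid of words (written additively, as \<open>\<Rightarrow>\<^sub>0\<close> requires).\<close>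

type_synonym free_alg = "mword \<Rightarrow>\<^sub>0 complex"

definition scal :: "complex \<Rightarrow> free_alg" where
  "scal c = Poly_Mapping.single 0 c"

definition gen :: "gen \<Rightarrow> free_alg" where
  "gen x = Poly_Mapping.single (MWord [x]) 1"

definition ann :: free_alg where "ann = gen Ann"

definition cre :: free_alg where "cre = gen Cre"

text \<open>\<open>fn g\<close> stands for \<open>g(H)\<close>.\<close>

definition fn :: "(complex \<Rightarrow> complex) \<Rightarrow> free_alg" where "fn g = gen (Fun g)"

definition ham :: free_alg where "ham = fn (\<lambda>x. x)"

text \<open>The first four rules say that \<open>g \<mapsto> g(H)\<close> is a unital algebra homomorphism on functions
  on \<open>D\<close>.  The relations \<open>a H = f(H) a\<close> and \<open>H a\<^sup>\<dagger> = a\<^sup>\<dagger> f(H)\<close> are imposed in their form for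
  arbitrary functions \<open>g\<close> of \<open>H\<close>, as polynomials in \<open>H\<close> do not exhaust the functions of \<open>H\<close>.\<close>

inductive_set relators :: "complex set \<Rightarrow> (complex \<Rightarrow> complex) \<Rightarrow> free_alg set"
  for D :: "complex set" and f :: "complex \<Rightarrow> complex" where
  rel_restrict: "(\<And>x. x \<in> D \<Longrightarrow> g x = h x) \<Longrightarrow> fn g - fn h \<in> relators D f"
| rel_const: "fn (\<lambda>_. c) - scal c \<in> relators D f"
| rel_add: "fn (\<lambda>x. g x + h x) - (fn g + fn h) \<in> relators D f"
| rel_mult: "fn (\<lambda>x. g x * h x) - fn g * fn h \<in> relators D f"
| rel_ann: "ann * fn g - fn (g \<circ> f) * ann \<in> relators D f"
| rel_cre: "fn g * cre - cre * fn (g \<circ> f) \<in> relators D f"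
| rel_comm: "(ann * cre - cre * ann) - (fn f - ham) \<in> relators D f"

text \<open>The two-sided ideal generated by the relators (closed under negation and scalars because
  \<open>u\<close> and \<open>v\<close> range over the whole free algebra).\<close>

inductive_set gha_ideal :: "complex set \<Rightarrow> (complex \<Rightarrow> complex) \<Rightarrow> free_alg set"
  for D :: "complex set" and f :: "complex \<Rightarrow> complex" where
  ideal_zero: "0 \<in> gha_ideal D f"
| ideal_add: "p \<in> gha_ideal D f \<Longrightarrow> q \<in> gha_ideal D f \<Longrightarrow> p + q \<in> gha_ideal D f"
| ideal_gen: "\<rho> \<in> relators D f \<Longrightarrow> u * \<rho> * v \<in> gha_ideal D f"

text \<open>Equality in \<open>GHA\<^sub>f\<close>, the quotient of the free algebra by that ideal.\<close>

definition gha_eq :: "complex set \<Rightarrow> (complex \<Rightarrow> complex) \<Rightarrow> free_alg \<Rightarrow> free_alg \<Rightarrow> bool" where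
  "gha_eq D f p q \<longleftrightarrow> p - q \<in> gha_ideal D f"

text \<open>The normalisation (zero for \<open>k > n\<close> and outside \<open>D\<close>) makes the coefficients unique as
  HOL functions.\<close>

definition rstirling1_coeffs ::
  "complex set \<Rightarrow> (complex \<Rightarrow> complex) \<Rightarrow> real \<Rightarrow> nat \<Rightarrow> nat \<Rightarrow> (nat \<Rightarrow> complex \<Rightarrow> complex) \<Rightarrow> bool" where
  "rstirling1_coeffs D f lam r n c \<longleftrightarrow>
     (\<forall>k x. k > n \<or> x \<notin> D \<longrightarrow> c k x = 0) \<and>
     gha_eq D f (ffact (cre * ann) n)
       (\<Sum>k=0..n. fn (c k) *
          dffact (scal (complex_of_real lam)) (cre * ann + fn (fbracket D f (int r))) k)"

text \<open>As in the usual notation, the indices are shifted by \<open>r\<close>: the coefficient of index \<open>k\<close>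
  in the expansion of the \<open>n\<close>-th falling factorial is \<open>rstirling1 D f lam r (n + r) (k + r)\<close>.\<close>

definition rstirling1 ::
  "complex set \<Rightarrow> (complex \<Rightarrow> complex) \<Rightarrow> real \<Rightarrow> nat \<Rightarrow> nat \<Rightarrow> nat \<Rightarrow> complex \<Rightarrow> complex" where
  "rstirling1 D f lam r N K = (THE c. rstirling1_coeffs D f lam r (N - r) c) (K - r)"

lemma ideal_mult_left: "p \<in> gha_ideal D f \<Longrightarrow> w * p \<in> gha_ideal D f"
proof (induction rule: gha_ideal.induct)
  case (ideal_gen \<rho> u v)
  then show ?case using gha_ideal.ideal_gen[of \<rho> D f "w * u" v] by (simp add: mult.assoc)
qed (auto simp: distrib_left intro: gha_ideal.intros)

lemma ideal_mult_right: "p \<in> gha_ideal D f \<Longrightarrow> p * w \<in> gha_ideal D f"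
proof (induction rule: gha_ideal.induct)
  case (ideal_gen \<rho> u v)
  then show ?case using gha_ideal.ideal_gen[of \<rho> D f u "v * w"] by (simp add: mult.assoc)
qed (auto simp: distrib_right intro: gha_ideal.intros)

lemma ideal_uminus: "p \<in> gha_ideal D f \<Longrightarrow> - p \<in> gha_ideal D f"
  using ideal_mult_left[of p D f "-1"] by simp

lemma gha_refl [simp]: "gha_eq D f p p"
  by (simp add: gha_eq_def ideal_zero)

lemma gha_sym: "gha_eq D f p q \<Longrightarrow> gha_eq D f q p"
  unfolding gha_eq_def using ideal_uminus[of "p - q"] by simp

lemma gha_trans [trans]: "gha_eq D f p q \<Longrightarrow> gha_eq D f q s \<Longrightarrow> gha_eq D f p s"
  unfolding gha_eq_def using ideal_add[of "p - q" D f "q - s"] by simp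

lemma gha_eq_trans1 [trans]: "p = q \<Longrightarrow> gha_eq D f q s \<Longrightarrow> gha_eq D f p s"
  by simp

lemma gha_eq_trans2 [trans]: "gha_eq D f p q \<Longrightarrow> q = s \<Longrightarrow> gha_eq D f p s"
  by simp

lemma gha_add: "gha_eq D f p q \<Longrightarrow> gha_eq D f p' q' \<Longrightarrow> gha_eq D f (p + p') (q + q')"
  unfolding gha_eq_def using ideal_add[of "p - q" D f "p' - q'"] by (simp add: algebra_simps)

lemma gha_diff: "gha_eq D f p q \<Longrightarrow> gha_eq D f p' q' \<Longrightarrow> gha_eq D f (p - p') (q - q')"
  unfolding gha_eq_def using ideal_add[of "p - q" D f "-(p' - q')"] ideal_uminus[of "p' - q'"]
  by (simp add: algebra_simps)

lemma gha_mult: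
  assumes "gha_eq D f p q" "gha_eq D f p' q'"
  shows "gha_eq D f (p * p') (q * q')"
proof -
  have "p * p' - q * q' = (p - q) * p' + q * (p' - q')" by (simp add: algebra_simps)
  then show ?thesis using assms unfolding gha_eq_def
    by (simp add: ideal_add ideal_mult_left ideal_mult_right)
qed

lemma gha_sum: "(\<And>i. i \<in> A \<Longrightarrow> gha_eq D f (p i) (q i)) \<Longrightarrow> gha_eq D f (sum p A) (sum q A)"
  by (induction A rule: infinite_finite_induct) (auto intro: gha_add)

lemma gha_rel: "p - q \<in> relators D f \<Longrightarrow> gha_eq D f p q"
  unfolding gha_eq_def using ideal_gen[of "p - q" D f 1 1] by simp

lemmas gha_restrict = gha_rel[OF rel_restrict]
lemmas gha_const = gha_rel[OF rel_const]
lemmas gha_fn_add = gha_rel[OF rel_add]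
lemmas gha_fn_mult = gha_rel[OF rel_mult]
lemmas gha_ann = gha_rel[OF rel_ann]
lemmas gha_cre = gha_rel[OF rel_cre]

lemma fn_num_comm: "gha_eq D f (fn g * (cre * ann)) (cre * ann * fn g)"
proof -
  have "gha_eq D f ((fn g * cre) * ann) ((cre * fn (g \<circ> f)) * ann)"
    by (intro gha_mult gha_cre gha_refl)
  also have "\<dots> = cre * (fn (g \<circ> f) * ann)" by (simp add: mult.assoc)
  also have "gha_eq D f \<dots> (cre * (ann * fn g))"
    by (intro gha_mult gha_sym[OF gha_ann] gha_refl)
  finally show ?thesis by (simp add: mult.assoc)
qed

lemma fn_fn_comm: "gha_eq D f (fn g * fn h) (fn h * fn g)"
proof -
  have "gha_eq D f (fn g * fn h) (fn (\<lambda>x. g x * h x))" by (rule gha_sym[OF gha_fn_mult])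
  also have "\<dots> = fn (\<lambda>x. h x * g x)" by (simp add: mult.commute)
  also have "gha_eq D f \<dots> (fn h * fn g)" by (rule gha_fn_mult)
  finally show ?thesis .
qed

lemma free_alg_induct [case_names single add]:
  fixes p :: free_alg
  assumes "\<And>w c. P (Poly_Mapping.single w c)" "\<And>p q. P p \<Longrightarrow> P q \<Longrightarrow> P (p + q)"
  shows "P p"
proof (induction p rule: update_induct)
  case const
  then show ?case using assms(1)[of 0 0] by simp
next
  case (update p w c)
  have "Poly_Mapping.update w c p = p + Poly_Mapping.single w c"
    using update(1)
    by (intro poly_mapping_eqI) (auto simp: lookup_update lookup_add lookup_single in_keys_iff when_def)
  then show ?case using assms update by metis
qed

lemma scal_comm: "scal c * p = p * scal c"
  by (induction p rule: free_alg_induct)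
     (simp_all add: scal_def mult_single distrib_left distrib_right mult.commute)

lemma scal_of_nat: "scal (of_nat n) = of_nat n"
  by (simp add: scal_def)

lemma scal_mult: "scal (c * d) = scal c * scal d"
  by (simp add: scal_def mult_single)

lemma dffact_0 [simp]: "dffact l x 0 = 1" and
  dffact_Suc: "dffact l x (Suc n) = dffact l x n * (x - of_nat n * l)"
  by (simp_all add: dffact_def)

lemma ffact_0 [simp]: "ffact x 0 = 1" and
  ffact_Suc: "ffact x (Suc n) = ffact x n * (x - of_nat n)"
  by (simp_all add: ffact_def)

lemma fn_dffact_comm:
  "gha_eq D f (dffact (scal c) (cre * ann + fn b) k * fn h) (fn h * dffact (scal c) (cre * ann + fn b) k)"
proof (induction k)
  case (Suc k)
  let ?X = "cre * ann + fn b"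
  let ?d = "dffact (scal c) ?X k" and ?y = "?X - of_nat k * scal c"
  have X: "gha_eq D f (?X * fn h) (fn h * ?X)"
    unfolding distrib_left distrib_right by (intro gha_add gha_sym[OF fn_num_comm] fn_fn_comm)
  have "of_nat k * scal c * fn h = fn h * (of_nat k * scal c)"
    unfolding scal_of_nat[symmetric] scal_mult[symmetric] by (rule scal_comm)
  then have y: "gha_eq D f (?y * fn h) (fn h * ?y)"
    unfolding left_diff_distrib right_diff_distrib by (metis gha_diff[OF X gha_refl])
  have "gha_eq D f (?d * (?y * fn h)) (?d * (fn h * ?y))"
    by (intro gha_mult y gha_refl)
  also have "\<dots> = (?d * fn h) * ?y" by (simp add: mult.assoc)
  also have "gha_eq D f \<dots> ((fn h * ?d) * ?y)"
    by (intro gha_mult Suc gha_refl)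
  finally show ?case by (simp add: dffact_Suc mult.assoc)
qed simp

lemma fn_diff: "gha_eq D f (fn (\<lambda>x. g x - h x)) (fn g - fn h)"
proof -
  have "gha_eq D f (fn (\<lambda>x. (g x - h x) + h x)) (fn (\<lambda>x. g x - h x) + fn h)"
    by (rule gha_fn_add)
  then have "gha_eq D f (fn g - fn h) ((fn (\<lambda>x. g x - h x) + fn h) - fn h)"
    by (intro gha_diff) simp_all
  then show ?thesis by (simp add: gha_sym)
qed

lemma fn_zero: "gha_eq D f (fn (\<lambda>_. 0)) 0"
  using gha_const[where c = 0] by (simp add: scal_def)

lemma coeffs_exist: "\<exists>c. rstirling1_coeffs D f lam r n c"
proof (induction n)
  case 0
  define c where "c = (\<lambda>(k::nat) x. if k = 0 \<and> x \<in> D then 1 else (0::complex))"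
  have "gha_eq D f (fn (c 0)) (fn (\<lambda>_. 1))" by (rule gha_restrict) (simp add: c_def)
  also have "gha_eq D f \<dots> (scal 1)" by (rule gha_const)
  finally have "gha_eq D f 1 (fn (c 0))" by (simp add: scal_def gha_sym)
  then show ?case
    by (intro exI[of _ c]) (simp add: rstirling1_coeffs_def, simp add: c_def)
next
  case (Suc n)
  then obtain c where c0: "\<And>k x. k > n \<or> x \<notin> D \<Longrightarrow> c k x = 0"
    and c: "gha_eq D f (ffact (cre * ann) n)
       (\<Sum>k=0..n. fn (c k) * dffact (scal (of_real lam)) (cre * ann + fn (fbracket D f (int r))) k)"
    unfolding rstirling1_coeffs_def by blast
  define b where "b = fbracket D f (int r)"
  define X where "X = cre * ann + fn b"
  define d where "d = dffact (scal (of_real lam)) X"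
  define h where "h = (\<lambda>k x. of_nat k * of_real lam - b x - of_nat n :: complex)"
  define c' where "c' = (\<lambda>k x. (case k of 0 \<Rightarrow> 0 | Suc j \<Rightarrow> c j x) + c k x * h k x)"
  have c'0: "c' 0 = (\<lambda>x. c 0 x * h 0 x)"
    and c'_Suc: "c' (Suc k) = (\<lambda>x. c k x + c (Suc k) x * h (Suc k) x)" for k
    by (simp_all add: c'_def)
  have step: "gha_eq D f ((fn (c k) * d k) * (cre * ann - of_nat n))
      (fn (c k) * d (Suc k) + fn (\<lambda>x. c k x * h k x) * d k)" for k
  proof -
    have "gha_eq D f (fn (h k)) (fn (\<lambda>x. of_nat k * of_real lam - b x) - fn (\<lambda>_. of_nat n))"
      unfolding h_def by (rule fn_diff)
    also have "gha_eq D f \<dots> ((fn (\<lambda>_. of_nat k * of_real lam) - fn b) - scal (of_nat n))"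
      by (intro gha_diff fn_diff gha_const)
    also have "gha_eq D f \<dots> ((scal (of_nat k * of_real lam) - fn b) - scal (of_nat n))"
      by (intro gha_diff gha_const gha_refl)
    finally have h: "gha_eq D f (scal (of_nat k * of_real lam) - fn b - of_nat n) (fn (h k))"
      by (simp add: scal_of_nat gha_sym)
    have "(fn (c k) * d k) * (cre * ann - of_nat n) = fn (c k) * d (Suc k) +
        fn (c k) * (d k * (scal (of_nat k * of_real lam) - fn b - of_nat n))"
      by (simp add: d_def dffact_Suc X_def algebra_simps scal_mult scal_of_nat)
    also have "gha_eq D f \<dots> (fn (c k) * d (Suc k) + fn (c k) * (d k * fn (h k)))"
      by (intro gha_add gha_mult h gha_refl)
    also have "gha_eq D f \<dots> (fn (c k) * d (Suc k) + fn (c k) * (fn (h k) * d k))"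
      unfolding d_def X_def by (intro gha_add gha_mult fn_dffact_comm gha_refl)
    also have "\<dots> = fn (c k) * d (Suc k) + (fn (c k) * fn (h k)) * d k"
      by (simp add: mult.assoc)
    also have "gha_eq D f \<dots> (fn (c k) * d (Suc k) + fn (\<lambda>x. c k x * h k x) * d k)"
      by (intro gha_add gha_mult gha_sym[OF gha_fn_mult] gha_refl)
    finally show ?thesis .
  qed
  have last: "gha_eq D f (fn (\<lambda>x. c (Suc n) x * h (Suc n) x) * d (Suc n)) 0"
  proof -
    have "gha_eq D f (fn (\<lambda>x. c (Suc n) x * h (Suc n) x) * d (Suc n)) (0 * d (Suc n))"
      using c0 by (intro gha_mult gha_refl gha_trans[OF gha_restrict fn_zero]) auto
    then show ?thesis by simp
  qed
  have "gha_eq D f (ffact (cre * ann) (Suc n)) ((\<Sum>k=0..n. fn (c k) * d k) * (cre * ann - of_nat n))"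
    unfolding ffact_Suc d_def X_def b_def by (intro gha_mult c gha_refl)
  also have "\<dots> = (\<Sum>k=0..n. (fn (c k) * d k) * (cre * ann - of_nat n))"
    by (rule sum_distrib_right)
  also have "gha_eq D f \<dots> (\<Sum>k=0..n. fn (c k) * d (Suc k) + fn (\<lambda>x. c k x * h k x) * d k)"
    by (intro gha_sum step)
  also have "gha_eq D f \<dots> ((\<Sum>k=0..n. fn (c k) * d (Suc k) + fn (\<lambda>x. c k x * h k x) * d k)
      + fn (\<lambda>x. c (Suc n) x * h (Suc n) x) * d (Suc n))"
    using gha_add[OF gha_refl gha_sym[OF last]] by simp
  also have "\<dots> = (\<Sum>k=0..n. fn (c k) * d (Suc k)) + (\<Sum>k=0..Suc n. fn (\<lambda>x. c k x * h k x) * d k)"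
    by (simp add: sum.distrib)
  also have "\<dots> = fn (\<lambda>x. c 0 x * h 0 x) * d 0 +
      (\<Sum>k=0..n. (fn (c k) + fn (\<lambda>x. c (Suc k) x * h (Suc k) x)) * d (Suc k))"
    unfolding sum.atLeast0_atMost_Suc_shift by (simp add: sum.distrib distrib_right)
  also have "gha_eq D f \<dots> (fn (c' 0) * d 0 + (\<Sum>k=0..n. fn (c' (Suc k)) * d (Suc k)))"
    unfolding c'0 c'_Suc by (intro gha_add gha_sum gha_mult gha_sym[OF gha_fn_add] gha_refl)
  also have "\<dots> = (\<Sum>k=0..Suc n. fn (c' k) * d k)"
    unfolding sum.atLeast0_atMost_Suc_shift by simp
  finally have "gha_eq D f (ffact (cre * ann) (Suc n)) (\<Sum>k=0..Suc n. fn (c' k) * d k)" .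
  moreover have "c' k x = 0" if "k > Suc n \<or> x \<notin> D" for k x
    using that c0 by (auto simp: c'_def split: nat.split)
  ultimately show ?case
    unfolding rstirling1_coeffs_def d_def X_def b_def by blast
qed

text \<open>A representation on functions of two variables, in which \<open>H\<close> and \<open>a\<^sup>\<dagger> a\<close> act by
  multiplication with the first and the second variable; it shows that the functions of \<open>H\<close> and
  \<open>a\<^sup>\<dagger> a\<close> generate a polynomial ring inside the algebra.\<close>

fun act :: "complex set \<Rightarrow> (complex \<Rightarrow> complex) \<Rightarrow> gen \<Rightarrow>
    (complex \<times> complex \<Rightarrow> complex) \<Rightarrow> complex \<times> complex \<Rightarrow> complex" where
  "act D f Ann \<phi> = (\<lambda>(d, x). \<phi> (f d, x + f d - d))"
| "act D f Cre \<phi> = (\<lambda>(d, x). x * \<phi> (inv_into D f d, x - d + inv_into D f d))"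
| "act D f (Fun g) \<phi> = (\<lambda>(d, x). g d * \<phi> (d, x))"

definition rep :: "complex set \<Rightarrow> (complex \<Rightarrow> complex) \<Rightarrow> free_alg \<Rightarrow>
    (complex \<times> complex \<Rightarrow> complex) \<Rightarrow> complex \<times> complex \<Rightarrow> complex" where
  "rep D f p \<phi> y = (\<Sum>w. Poly_Mapping.lookup p w * foldr (act D f) (letters w) \<phi> y)"

lemma act_add: "act D f s (\<lambda>y. \<phi> y + \<psi> y) = (\<lambda>y. act D f s \<phi> y + act D f s \<psi> y)"
  by (cases s) (auto simp: algebra_simps)

lemma act_scale: "act D f s (\<lambda>y. c * \<phi> y) = (\<lambda>y. c * act D f s \<phi> y)"
  by (cases s) auto

lemma foldr_act_add:
  "foldr (act D f) ws (\<lambda>y. \<phi> y + \<psi> y) = (\<lambda>y. foldr (act D f) ws \<phi> y + foldr (act D f) ws \<psi> y)"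
  by (induction ws) (simp_all add: act_add)

lemma foldr_act_scale:
  "foldr (act D f) ws (\<lambda>y. c * \<phi> y) = (\<lambda>y. c * foldr (act D f) ws \<phi> y)"
  by (induction ws) (simp_all add: act_scale)

lemma finite_rep: "finite {w. Poly_Mapping.lookup p w * F w \<noteq> (0::complex)}"
  by (rule finite_subset[OF _ finite_lookup[of p]]) auto

lemma rep_add: "rep D f (p + q) \<phi> = (\<lambda>y. rep D f p \<phi> y + rep D f q \<phi> y)"
  by (simp add: rep_def lookup_add distrib_right Sum_any.distrib finite_rep fun_eq_iff)

lemma rep_single: "rep D f (Poly_Mapping.single w c) \<phi> = (\<lambda>y. c * foldr (act D f) (letters w) \<phi> y)"
proof
  fix y
  let ?g = "\<lambda>v. Poly_Mapping.lookup (Poly_Mapping.single w c) v * foldr (act D f) (letters v) \<phi> y"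
  have "Sum_any ?g = sum ?g {w}"
    by (rule Sum_any.expand_superset) (auto simp: lookup_single when_def)
  then show "rep D f (Poly_Mapping.single w c) \<phi> y = c * foldr (act D f) (letters w) \<phi> y"
    by (simp add: rep_def)
qed

lemma rep_fun_add: "rep D f p (\<lambda>y. \<phi> y + \<psi> y) = (\<lambda>y. rep D f p \<phi> y + rep D f p \<psi> y)"
  by (induction p rule: free_alg_induct)
     (simp_all add: rep_single rep_add foldr_act_add distrib_left fun_eq_iff)

lemma rep_mult: "rep D f (p * q) \<phi> = rep D f p (rep D f q \<phi>)"
proof (induction p rule: free_alg_induct)
  case (single v c)
  show ?case
    by (induction q rule: free_alg_induct)
       (simp_all add: mult_single rep_single rep_add rep_fun_add distrib_left plus_mword_def
          foldr_act_scale mult.assoc)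
next
  case (add p p')
  then show ?case by (simp add: distrib_right rep_add)
qed

lemma letters_0: "letters 0 = []"
  by (simp add: zero_mword_def)

lemma rep_zero: "rep D f 0 \<phi> = (\<lambda>_. 0)"
  using rep_single[of D f 0 0] by simp

lemma rep_one: "rep D f 1 \<phi> = \<phi>"
  using rep_single[of D f 0 1 \<phi>] by (simp add: letters_0)

lemma rep_uminus: "rep D f (- p) \<phi> = (\<lambda>y. - rep D f p \<phi> y)"
proof
  fix y
  have "rep D f (- p) \<phi> y + rep D f p \<phi> y = 0"
    using fun_cong[OF rep_add[of D f "- p" p \<phi>], of y] by (simp add: rep_zero)
  then show "rep D f (- p) \<phi> y = - rep D f p \<phi> y" by (simp add: add_eq_0_iff2)
qed

lemma rep_diff: "rep D f (p - q) \<phi> = (\<lambda>y. rep D f p \<phi> y - rep D f q \<phi> y)"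
  using rep_add[of D f p "- q"] by (simp add: rep_uminus)

lemma rep_scal: "rep D f (scal c) \<phi> = (\<lambda>y. c * \<phi> y)"
  by (simp add: scal_def rep_single zero_mword_def)

lemma rep_gen: "rep D f (gen s) \<phi> = act D f s \<phi>"
  by (simp add: gen_def rep_single)

lemma rep_sum: "rep D f (sum p A) \<phi> = (\<lambda>y. \<Sum>i\<in>A. rep D f (p i) \<phi> y)"
  by (induction A rule: infinite_finite_induct) (simp_all add: rep_zero rep_add)

lemmas rep_gens = ann_def cre_def fn_def ham_def rep_gen

definition vanishes :: "complex set \<Rightarrow> (complex \<times> complex \<Rightarrow> complex) \<Rightarrow> bool" where
  "vanishes D \<phi> \<longleftrightarrow> (\<forall>d\<in>D. \<forall>x. \<phi> (d, x) = 0)"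

lemma rep_vanishes:
  assumes "bij_betw f D D" "vanishes D \<phi>"
  shows "vanishes D (rep D f p \<phi>)"
proof (induction p rule: free_alg_induct)
  case (single w c)
  have "vanishes D (act D f s \<psi>)" if "vanishes D \<psi>" for s \<psi>
    using that assms(1) bij_betwE[OF assms(1)] bij_betwE[OF bij_betw_inv_into[OF assms(1)]]
    by (cases s) (auto simp: vanishes_def)
  then have "vanishes D (foldr (act D f) ws \<phi>)" for ws
    by (induction ws) (use assms(2) in auto)
  then show ?case by (simp add: rep_single vanishes_def)
qed (simp add: rep_add vanishes_def)

lemma rep_relators:
  assumes "bij_betw f D D" "\<rho> \<in> relators D f"
  shows "vanishes D (rep D f \<rho> \<phi>)"
  using assms(2)
proof induction
  case (rel_cre g)
  have "f (inv_into D f d) = d" if "d \<in> D" for d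
    using that assms(1) by (simp add: bij_betw_inv_into_right)
  then show ?case by (auto simp: rep_diff rep_mult rep_gens vanishes_def)
next
  case rel_comm
  have "f (inv_into D f d) = d" "inv_into D f (f d) = d" if "d \<in> D" for d
    using that assms(1) by (simp_all add: bij_betw_inv_into_right bij_betw_inv_into_left)
  then show ?case
    by (simp add: rep_diff rep_mult rep_gens vanishes_def) (simp add: algebra_simps)
qed (simp_all add: rep_diff rep_add rep_mult rep_gens rep_scal vanishes_def distrib_right mult.assoc)

lemma rep_ideal:
  assumes "bij_betw f D D" "p \<in> gha_ideal D f"
  shows "vanishes D (rep D f p \<phi>)"
  using assms(2)
proof (induction)
  case (ideal_gen \<rho> u v)
  then show ?case by (simp add: rep_mult rep_vanishes rep_relators assms(1))
qed (simp_all add: rep_zero rep_add vanishes_def)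

lemma rep_gha_eq:
  assumes "bij_betw f D D" "gha_eq D f p q" "d \<in> D"
  shows "rep D f p \<phi> (d, x) = rep D f q \<phi> (d, x)"
  using rep_ideal[OF assms(1), of "p - q" \<phi>] assms(2,3)
  by (simp add: gha_eq_def rep_diff vanishes_def)

lemma rep_fn: "rep D f (fn g) \<phi> = (\<lambda>(d, x). g d * \<phi> (d, x))"
  and rep_ann: "rep D f ann \<phi> = (\<lambda>(d, x). \<phi> (f d, x + f d - d))"
  and rep_cre: "rep D f cre \<phi> = (\<lambda>(d, x). x * \<phi> (inv_into D f d, x - d + inv_into D f d))"
  by (simp_all add: rep_gens)

lemma rep_dffact:
  assumes "bij_betw f D D" "d \<in> D"
  shows "rep D f (dffact (scal c) (cre * ann + fn b) k) \<phi> (d, x) =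
    (\<Prod>j<k. x + b d - of_nat j * c) * \<phi> (d, x)"
proof (induction k arbitrary: \<phi>)
  case (Suc k)
  have "f (inv_into D f d) = d"
    using assms by (simp add: bij_betw_inv_into_right)
  then show ?case
    by (simp add: dffact_Suc rep_mult Suc rep_diff rep_add rep_scal rep_cre rep_ann rep_fn
        scal_of_nat[symmetric]) (simp add: algebra_simps)
qed (simp add: rep_one)

lemma coeffs_unique:
  assumes "bij_betw f D D" "lam \<noteq> 0" "rstirling1_coeffs D f lam r n c" "rstirling1_coeffs D f lam r n c'"
  shows "c = c'"
proof (intro ext)
  fix k d
  show "c k d = c' k d"
  proof (cases "k \<le> n \<and> d \<in> D")
    case False
    then show ?thesis using assms(3,4) unfolding rstirling1_coeffs_def
      by (metis not_le)
  next
    case True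
    define b where "b = fbracket D f (int r)"
    define P where "P = (\<lambda>x k. \<Prod>j<k. x + b d - of_nat j * complex_of_real lam)"
    have "gha_eq D f (\<Sum>k=0..n. fn (c k) * dffact (scal (of_real lam)) (cre * ann + fn b) k)
        (\<Sum>k=0..n. fn (c' k) * dffact (scal (of_real lam)) (cre * ann + fn b) k)"
      using assms(3,4) unfolding rstirling1_coeffs_def b_def by (blast intro: gha_trans gha_sym)
    from rep_gha_eq[OF assms(1) this, of d "\<lambda>_. 1"]
    have eq: "(\<Sum>k=0..n. c k d * P x k) = (\<Sum>k=0..n. c' k d * P x k)" for x
      using True by (simp add: rep_sum rep_mult rep_fn rep_dffact[OF assms(1)] P_def)
    from True have "k \<le> n" by simp
    then show ?thesis
    proof (induction k rule: less_induct)
      case (less k)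
      define x where "x = of_nat k * complex_of_real lam - b d"
      have P0: "P x i = 0" if "i > k" for i
        using that by (auto simp: P_def x_def)
      have Pk: "P x k \<noteq> 0"
        using assms(2) by (auto simp: P_def x_def left_diff_distrib[symmetric])
      have split: "(\<Sum>i=0..n. e i * P x i) = (\<Sum>i<k. e i * P x i) + e k * P x k" for e
      proof -
        have "(\<Sum>i=0..n. e i * P x i) = (\<Sum>i\<in>insert k {..<k}. e i * P x i)"
          using less.prems by (intro sum.mono_neutral_right) (auto simp: P0 not_less)
        then show ?thesis by (simp add: add.commute)
      qed
      have "(\<Sum>i<k. c i d * P x i) = (\<Sum>i<k. c' i d * P x i)"
        using less by (intro sum.cong) auto
      then show ?case using eq[of x] Pk by (simp add: split)
    qed
  qed
qed

lemma rstirling1_coeffs_ex1: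
  assumes "bij_betw f D D" "lam \<noteq> 0"
  shows "\<exists>!c. rstirling1_coeffs D f lam r n c"
  using coeffs_exist coeffs_unique[OF assms] by metis

lemma rstirling1_coeffs_rstirling1:
  assumes "bij_betw f D D" "lam \<noteq> 0"
  shows "rstirling1_coeffs D f lam r n (\<lambda>k. rstirling1 D f lam r (n + r) (k + r))"
  using theI'[OF rstirling1_coeffs_ex1[OF assms, of r n]] by (simp add: rstirling1_def)

end

theory Submission
  imports Defs
begin

text \<open>
  Write \<open>N = a\<^sup>\<dagger> a\<close> and \<open>u = (a\<^sup>\<dagger>)\<^sup>r\<close>.  The theorem says that the expansion defining the
  \<open>r\<close>-Stirling operators can be carried through \<open>u\<close> from left to right.  Passing \<open>u\<close> has two
  effects.  A function \<open>g(H)\<close> becomes \<open>g(f\<^sup>-\<^sup>r(H))\<close>, since \<open>u g(f\<^sup>r(H)) = g(H) u\<close> by iterating the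
  relation \<open>H a\<^sup>\<dagger> = a\<^sup>\<dagger> f(H)\<close> (lemma \<open>cre_power_fn\<close>).  And \<open>N + [r]\<^sub>f(H)\<close> becomes \<open>N\<close>: the
  commutator relation gives \<open>N a\<^sup>\<dagger> = a\<^sup>\<dagger> (N + f(H) - H)\<close>, and over \<open>r\<close> factors the increments
  \<open>f(H) - H\<close>, each moved to the right past the remaining factors, telescope to
  \<open>f\<^sup>r(H) - H = [r]\<^sub>f(H)\<close> (lemma \<open>num_cre_power\<close>).

  As scalars are central, \<open>u\<close> then also intertwines the degenerate falling factorials of
  \<open>N + [r]\<^sub>f(H)\<close> with those of \<open>N\<close> (lemma \<open>dffact_intertwine\<close>).  Multiplying the defining
  expansion of \<open>(N)\<^sub>n\<close> by \<open>u\<close> on the left and moving \<open>u\<close> through each summand gives the claim.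
\<close>

lemma fn_cre_power: "gha_eq D f (fn g * cre ^ r) (cre ^ r * fn (g \<circ> f ^^ r))"
proof (induction r arbitrary: g)
  case (Suc r)
  have "gha_eq D f ((fn g * cre) * cre ^ r) ((cre * fn (g \<circ> f)) * cre ^ r)"
    by (intro gha_mult gha_cre gha_refl)
  also have "\<dots> = cre * (fn (g \<circ> f) * cre ^ r)" by (simp add: mult.assoc)
  also have "gha_eq D f \<dots> (cre * (cre ^ r * fn ((g \<circ> f) \<circ> f ^^ r)))"
    by (intro gha_mult Suc gha_refl)
  finally show ?case by (simp add: mult.assoc comp_def)
qed simp

lemma fpow_neg_funpow:
  assumes "bij_betw f D D" "x \<in> D"
  shows "fpow D f (- int r) ((f ^^ r) x) = x"
proof -
  have "(inv_into D f ^^ r) ((f ^^ r) x) = x"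
    using assms(2)
  proof (induction r arbitrary: x)
    case (Suc r)
    then have "f x \<in> D" using bij_betwE[OF assms(1)] by blast
    then have "(inv_into D f ^^ r) ((f ^^ r) (f x)) = f x" by (rule Suc.IH)
    then show ?case
      using bij_betw_inv_into_left[OF assms(1) Suc.prems] by (simp add: funpow_swap1)
  qed simp
  then show ?thesis by (cases "r = 0") (simp_all add: fpow_def)
qed

lemma cre_power_fn:
  assumes "bij_betw f D D"
  shows "gha_eq D f (cre ^ r * fn g) (fn (g \<circ> fpow D f (- int r)) * cre ^ r)"
proof -
  \<comment> \<open>The inverse iterate cancels \<open>f ^^ r\<close> only on \<open>D\<close>, which is all that \<open>g(H)\<close> depends on.\<close>
  have "gha_eq D f (fn g) (fn ((g \<circ> fpow D f (- int r)) \<circ> f ^^ r))"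
    by (rule gha_restrict) (simp add: fpow_neg_funpow[OF assms])
  then have "gha_eq D f (cre ^ r * fn g) (cre ^ r * fn ((g \<circ> fpow D f (- int r)) \<circ> f ^^ r))"
    by (intro gha_mult gha_refl)
  then show ?thesis by (rule gha_trans[OF _ gha_sym[OF fn_cre_power]])
qed

text \<open>The induction splits off the factor next to \<open>[r]\<^sub>f(H)\<close>; moving it to the left turns
  \<open>[r]\<^sub>f(H)\<close> into \<open>f\<^sup>r\<^sup>+\<^sup>1(H) - f(H)\<close>, and the commutator contributes the missing \<open>f(H) - H\<close>.\<close>

lemma num_cre_power:
  "gha_eq D f ((cre * ann) * cre ^ r) (cre ^ r * (cre * ann + fn (fbracket D f (int r))))"
proof (induction r)
  case 0
  have "fbracket D f (int 0) = (\<lambda>_. 0)" by (simp add: fbracket_def fpow_def)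
  then have "gha_eq D f (cre * ann + fn (fbracket D f (int 0))) (cre * ann + 0)"
    by (simp only:) (intro gha_add fn_zero gha_refl)
  then show ?case by (simp add: gha_sym)
next
  case (Suc r)
  let ?N = "cre * ann" and ?b = "fbracket D f"
  have comm: "gha_eq D f (ann * cre) (?N + (fn f - ham))"
    using gha_add[OF gha_rel[OF rel_comm] gha_refl, of D f ?N] by (simp add: algebra_simps)
  have "?b (int (Suc r)) = (\<lambda>x. (f x - x) + (?b (int r) \<circ> f) x)"
    by (auto simp: fbracket_def fpow_def funpow_swap1 nat_add_distrib)
  then have "gha_eq D f (fn (?b (int (Suc r)))) (fn (\<lambda>x. f x - x) + fn (?b (int r) \<circ> f))"
    by (simp only: gha_fn_add)
  also have "gha_eq D f \<dots> ((fn f - ham) + fn (?b (int r) \<circ> f))"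
    unfolding ham_def by (intro gha_add fn_diff gha_refl)
  finally have tele:
    "gha_eq D f ((fn f - ham) + fn (?b (int r) \<circ> f)) (fn (?b (int (Suc r))))"
    by (rule gha_sym)
  have "?N * cre ^ Suc r = (?N * cre ^ r) * cre"
    by (simp add: power_Suc2 mult.assoc del: power_Suc)
  also have "gha_eq D f \<dots> ((cre ^ r * (?N + fn (?b (int r)))) * cre)"
    by (intro gha_mult Suc gha_refl)
  also have "\<dots> = cre ^ r * (cre * (ann * cre) + fn (?b (int r)) * cre)"
    by (simp add: mult.assoc distrib_left distrib_right)
  also have "gha_eq D f \<dots> (cre ^ r * (cre * (?N + (fn f - ham)) + cre * fn (?b (int r) \<circ> f)))"
    by (intro gha_mult gha_add comm gha_cre gha_refl)
  also have "\<dots> = cre ^ Suc r * (?N + ((fn f - ham) + fn (?b (int r) \<circ> f)))"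
    by (simp add: power_Suc2 mult.assoc distrib_left del: power_Suc)
  also have "gha_eq D f \<dots> (cre ^ Suc r * (?N + fn (?b (int (Suc r)))))"
    by (intro gha_mult gha_add tele gha_refl)
  finally show ?case .
qed

lemma dffact_intertwine:
  assumes "gha_eq D f (u * x) (y * u)"
  shows "gha_eq D f (u * dffact (scal c) x k) (dffact (scal c) y k * u)"
proof (induction k)
  case (Suc k)
  let ?l = "of_nat k * scal c"
  have "u * ?l = ?l * u"
    unfolding scal_of_nat[symmetric] scal_mult[symmetric] by (rule scal_comm[symmetric])
  then have factor: "gha_eq D f (u * (x - ?l)) ((y - ?l) * u)"
    unfolding left_diff_distrib right_diff_distrib by (metis gha_diff[OF assms gha_refl])
  have "u * dffact (scal c) x (Suc k) = (u * dffact (scal c) x k) * (x - ?l)"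
    by (simp add: dffact_Suc mult.assoc)
  also have "gha_eq D f \<dots> ((dffact (scal c) y k * u) * (x - ?l))"
    by (intro gha_mult Suc gha_refl)
  also have "\<dots> = dffact (scal c) y k * (u * (x - ?l))" by (simp add: mult.assoc)
  also have "gha_eq D f \<dots> (dffact (scal c) y k * ((y - ?l) * u))"
    by (intro gha_mult factor gha_refl)
  finally show ?case by (simp add: dffact_Suc mult.assoc)
qed simp

theorem theorem3p5:
  fixes D :: "complex set" and f :: "complex \<Rightarrow> complex" and lam :: real and n r :: nat
  assumes "D \<subseteq> \<real>" and "f analytic_on D" and "bij_betw f D D" and "lam \<noteq> 0"
  shows "gha_eq D f
    (cre ^ r * ffact (cre * ann) n)
    (\<Sum>k=0..n. fn (rstirling1 D f lam r (n + r) (k + r) \<circ> fpow D f (- int r)) *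
       dffact (scal (complex_of_real lam)) (cre * ann) k * cre ^ r)"
proof -
  define S where "S = (\<lambda>k. rstirling1 D f lam r (n + r) (k + r))"
  define d where "d = dffact (scal (complex_of_real lam))"
  let ?N = "cre * ann" and ?S' = "\<lambda>k. S k \<circ> fpow D f (- int r)"
  let ?X = "?N + fn (fbracket D f (int r))"
  have "gha_eq D f (ffact ?N n) (\<Sum>k=0..n. fn (S k) * d ?X k)"
    using rstirling1_coeffs_rstirling1[OF assms(3,4), of r n]
    unfolding rstirling1_coeffs_def S_def d_def by blast
  then have "gha_eq D f (cre ^ r * ffact ?N n) (cre ^ r * (\<Sum>k=0..n. fn (S k) * d ?X k))"
    by (intro gha_mult gha_refl)
  also have "\<dots> = (\<Sum>k=0..n. (cre ^ r * fn (S k)) * d ?X k)"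
    by (simp add: sum_distrib_left mult.assoc)
  also have "gha_eq D f \<dots> (\<Sum>k=0..n. (fn (?S' k) * cre ^ r) * d ?X k)"
    by (intro gha_sum gha_mult cre_power_fn[OF assms(3)] gha_refl)
  also have "\<dots> = (\<Sum>k=0..n. fn (?S' k) * (cre ^ r * d ?X k))"
    by (simp add: mult.assoc)
  also have "gha_eq D f \<dots> (\<Sum>k=0..n. fn (?S' k) * (d ?N k * cre ^ r))"
    unfolding d_def
    by (intro gha_sum gha_mult dffact_intertwine gha_sym[OF num_cre_power] gha_refl)
  finally show ?thesis by (simp add: S_def d_def mult.assoc)
qed

end
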